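(* Let $\mathbb{k}$ be a field and let $m,n$ be positive integers such that there exist $p,q\in\mathbb{k}^*$ with $\operatorname{ord}(p)=m$, $\operatorname{ord}(q)=n$ and $pq\neq1$. Let $l=\operatorname{lcm}(m,n)$. Then $\operatorname{ord}(pq)<l$ for all $p,q\in\mathbb{k}^*$ with $\operatorname{ord}(p)=m$, $\operatorname{ord}(q)=n$ and $pq\neq1$ if and only if $e_m(2)=e_n(2)\ge1$.
   Context: $\mathbb{k}^*=\mathbb{k}\setminus\{0\}$, and $\operatorname{ord}$ denotes multiplicative order. For a positive integer $k$, $e_k(2)$ denotes the exponent of the prime $2$ in the prime factorization of $k$ (so $e_k(2)=0$ if $k$ is odd). *)

theory Defs
  imports "HOL-Algebra.Multiplicative_Group" "HOL-Computational_Algebra.Primes"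
begin

end

theory Submission
  imports Defs "HOL-Number_Theory.Cong"
begin

text \<open>
  Let \<open>l = lcm m n\<close>. If \<open>m\<close> and \<open>n\<close> have the same positive 2-adic valuation, then \<open>p ^ (l div 2)\<close>
  and \<open>q ^ (l div 2)\<close> are square roots of 1 other than 1, hence both equal to \<open>- 1\<close>, and their
  product is 1. Conversely, we replace \<open>q\<close> by a power \<open>q ^ b\<close> of the same order. The product
  \<open>p * q ^ b\<close> has order \<open>l\<close> iff \<open>p ^ (l div r) * q ^ (b * (l div r)) \<noteq> 1\<close> for every prime \<open>r\<close>
  dividing \<open>l\<close>, which depends only on \<open>b mod r\<close>: the residue 1 works unless the two powers are
  inverse to each other, and then the residue 2 does. This is coprime to \<open>r\<close> except for
  \<open>r = 2\<close>, where the powers are inverse to each other only if the valuations agree and are positive.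
  The residues are combined by the Chinese remainder theorem.
\<close>

text \<open>With \<open>l = m * k\<close>, both sides say that \<open>r\<close> divides the cofactor
  \<open>k\<close>.\<close>

lemma dvd_div_prime_iff_multiplicity:
  fixes m l r :: nat
  assumes "prime r" "m dvd l" "l > 0" "r dvd l"
  shows "m dvd l div r \<longleftrightarrow> multiplicity r m < multiplicity r l"
proof -
  from \<open>m dvd l\<close> obtain k where l: "l = m * k" ..
  have nz: "m \<noteq> 0" "k \<noteq> 0" using l \<open>l > 0\<close> by auto
  have "m dvd l div r \<longleftrightarrow> r * m dvd l"
    using \<open>r dvd l\<close> \<open>prime r\<close> by (metis dvd_div_iff_mult dvd_mult_div_cancel mult.commute not_prime_0)
  also have "\<dots> \<longleftrightarrow> r dvd k"
    using nz by (simp add: l mult.commute)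
  also have "\<dots> \<longleftrightarrow> multiplicity r k > 0"
    using nz \<open>prime r\<close> by (simp add: prime_multiplicity_gt_zero_iff)
  also have "\<dots> \<longleftrightarrow> multiplicity r m < multiplicity r l"
    using nz \<open>prime r\<close> by (simp add: l prime_elem_multiplicity_mult_distrib)
  finally show ?thesis .
qed

lemma exists_cong_all_primes:
  fixes u :: "nat \<Rightarrow> nat" and l :: nat
  assumes "l > 0"
  shows "\<exists>b. \<forall>r. prime r \<and> r dvd l \<longrightarrow> [b = u r] (mod r)"
proof -
  have "\<exists>b. \<forall>r\<in>prime_factors l. [b = u r] (mod r)"
    by (rule chinese_remainder_nat) (auto intro: primes_coprime)
  then show ?thesis
    using assms by (auto simp: prime_factors_dvd)
qed

lemma (in group) ord_pow_coprime:
  assumes "x \<in> carrier G" "ord x = n" "coprime b n" "n > 0"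
  shows "ord (x [^] b) = n"
  \<comment> \<open>For \<open>b = 0\<close>, coprimality forces \<open>n = 1\<close>, the order of
    the identity.\<close>
  using assms by (cases "b = 0")
    (auto simp: ord_pow_gen gcd.commute coprime_iff_gcd_eq_1[symmetric] coprime_commute)

text \<open>Coprimality of \<open>b\<close> to \<open>ord q\<close> ensures that
  \<open>q [^] b\<close> has the same order as \<open>q\<close>, so it may replace \<open>q\<close>
  in the main equivalence.\<close>

lemma (in comm_group) ord_mult_pow_eq_lcm:
  assumes p: "p \<in> carrier G" and q: "q \<in> carrier G"
    and pos: "ord p > 0" "ord q > 0"
    and two: "\<not> (multiplicity 2 (ord p) = multiplicity 2 (ord q) \<and> multiplicity 2 (ord q) \<ge> 1)"
  shows "\<exists>b::nat. coprime b (ord q) \<and> ord (p \<otimes> q [^] b) = lcm (ord p) (ord q)"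
proof -
  define l where "l = lcm (ord p) (ord q)"
  have l: "l > 0" "ord p dvd l" "ord q dvd l"
    using pos by (auto simp: l_def intro: Nat.gr0I)
  define x y where "x r = p [^] (l div r)" and "y r = q [^] (l div r)" for r :: nat
  have xy_carr [simp]: "x r \<in> carrier G" "y r \<in> carrier G" for r
    using p q by (auto simp: x_def y_def)
  have x_eq: "x r = \<one> \<longleftrightarrow> ord p dvd l div r" and y_eq: "y r = \<one> \<longleftrightarrow> ord q dvd l div r" for r
    using p q by (auto simp: x_def y_def pow_eq_id)
  have y_pow_self: "y r [^] r = \<one>" if "r dvd l" for r
    using that p q l by (auto simp: y_def nat_pow_pow pow_eq_id)
  \<comment> \<open>The exponent is chosen so that \<open>x r \<otimes> y r [^] u r\<close> is not
    \<open>\<one>\<close>: if \<open>x r \<otimes> y r = \<one>\<close>, one more factor leaves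
    \<open>y r\<close>, which is nontrivial by \<open>y_ne\<close>.\<close>
  define u :: "nat \<Rightarrow> nat" where "u r = (if x r \<otimes> y r \<noteq> \<one> then 1 else 2)" for r
  \<comment> \<open>If \<open>y r\<close> were trivial, so would be \<open>x r\<close>; then both
    orders, hence their lcm \<open>l\<close>, would divide the smaller number
    \<open>l div r\<close>.\<close>
  have y_ne: "y r \<noteq> \<one>" if r: "prime r" "r dvd l" and xy: "x r \<otimes> y r = \<one>" for r
  proof
    assume "y r = \<one>"
    with xy have "x r = \<one>" by simp
    with \<open>y r = \<one>\<close> have "l dvd l div r"
      by (simp add: x_eq y_eq l_def)
    with l r show False
      by (metis dvd_div_eq_0_iff dvd_imp_le div_less_dividend leD not_gr_zero prime_gt_1_nat)
  qed
  \<comment> \<open>Otherwise \<open>x 2\<close> and \<open>y 2\<close> are both nontrivial, so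
    neither order divides \<open>l div 2\<close> and both have the full 2-adic valuation of
    \<open>l\<close>, against \<open>two\<close>.\<close>
  have not_two: "x 2 \<otimes> y 2 \<noteq> \<one>" if "2 dvd l"
  proof
    assume xy: "x 2 \<otimes> y 2 = \<one>"
    have ne: "y 2 \<noteq> \<one>" using y_ne[of 2] xy that by simp
    with xy have "x 2 \<noteq> \<one>" by auto
    with ne have "multiplicity 2 (ord p) = multiplicity 2 l" "multiplicity 2 (ord q) = multiplicity 2 l"
      using dvd_div_prime_iff_multiplicity[of 2 "ord p" l] dvd_div_prime_iff_multiplicity[of 2 "ord q" l]
        l that dvd_imp_multiplicity_le[of "ord p" l 2] dvd_imp_multiplicity_le[of "ord q" l 2]
      by (auto simp: x_eq y_eq)
    moreover have "multiplicity 2 l \<ge> 1"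
      using that l prime_multiplicity_gt_zero_iff[of 2 l] by simp
    ultimately show False using two by simp
  qed
  obtain b where b: "[b = u r] (mod r)" if "prime r" "r dvd l" for r
    using exists_cong_all_primes[OF l(1), of u] by blast
  have y_pow: "y r [^] b = y r [^] u r" if "prime r" "r dvd l" for r
  proof -
    have "y r [^] k = y r [^] (k mod r)" for k :: nat
    proof -
      have "y r [^] k = y r [^] (r * (k div r) + k mod r)" by simp
      also have "\<dots> = (y r [^] r) [^] (k div r) \<otimes> y r [^] (k mod r)"
        by (simp only: nat_pow_mult nat_pow_pow xy_carr)
      finally show ?thesis by (simp add: y_pow_self[OF that(2)])
    qed
    with b[OF that] show ?thesis by (metis cong_def)
  qed
  \<comment> \<open>A common prime \<open>r\<close> divides \<open>u r\<close>, which is 1 or 2; so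
    \<open>r = 2\<close> and \<open>u 2 = 2\<close>, which \<open>not_two\<close> excludes.\<close>
  have coprime_b: "coprime b l"
  proof (rule ccontr)
    assume "\<not> coprime b l"
    then obtain r where r: "prime r" "r dvd b" "r dvd l"
      by (metis coprime_iff_gcd_eq_1 gcd_nat.bounded_iff prime_factor_nat)
    have "r dvd u r" using b[OF r(1,3)] r(2) cong_dvd_iff by blast
    then have "x r \<otimes> y r = \<one> \<and> r = 2"
      using r(1) by (auto simp: u_def split: if_splits dest: primes_dvd_imp_eq[OF _ two_is_prime_nat])
    with not_two r show False by auto
  qed
  have key: "(p \<otimes> q [^] b) [^] (l div r) \<noteq> \<one>" if r: "prime r" "r dvd l" for r
  proof -
    have "(p \<otimes> q [^] b) [^] (l div r) = x r \<otimes> y r [^] b"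
      using p q by (simp add: x_def y_def pow_mult_distrib m_comm nat_pow_pow mult.commute)
    also have "\<dots> = x r \<otimes> y r [^] u r" by (simp add: y_pow[OF r])
    also have "\<dots> \<noteq> \<one>"
    proof (cases "x r \<otimes> y r = \<one>")
      case True
      have "x r \<otimes> y r [^] u r = (x r \<otimes> y r) \<otimes> y r"
        unfolding u_def using True by (simp only: numeral_2_eq_2) (simp add: m_assoc[symmetric])
      then show ?thesis using True y_ne[OF r] by simp
    qed (simp add: u_def)
    finally show ?thesis .
  qed
  have pqb: "p \<otimes> q [^] b \<in> carrier G" using p q by simp
  have "(p \<otimes> q [^] b) [^] l = p [^] l \<otimes> (q [^] l) [^] b"
    using p q by (simp add: pow_mult_distrib m_comm nat_pow_pow mult.commute)
  also have "\<dots> = \<one>" using p q l by (simp add: pow_eq_id[symmetric])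
  finally have dvd: "ord (p \<otimes> q [^] b) dvd l" using pqb by (simp add: pow_eq_id)
  \<comment> \<open>A prime \<open>r\<close> dividing the cofactor of a proper divisor would make
    the power with exponent \<open>l div r\<close> trivial, against \<open>key\<close>.\<close>
  have "ord (p \<otimes> q [^] b) = l"
  proof (rule ccontr)
    assume ne: "ord (p \<otimes> q [^] b) \<noteq> l"
    obtain k where k: "l = ord (p \<otimes> q [^] b) * k" using dvd ..
    with ne have "k \<noteq> 1" by auto
    then obtain r where r: "prime r" "r dvd k" using prime_factor_nat by blast
    then have "ord (p \<otimes> q [^] b) dvd l div r"
      using k by (auto elim!: dvdE simp: prime_gt_0_nat)
    with key[of r] r k pqb show False by (simp add: pow_eq_id)
  qed
  moreover have "coprime b (ord q)"
    using coprime_b l(3) by (meson coprime_divisors dvd_refl)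
  ultimately show ?thesis by (auto simp: l_def)
qed

theorem proposition8p3:
  fixes K :: "('a, 'b) ring_scheme" and m n :: nat
  assumes "field K"
    and "m > 0" and "n > 0"
    and "\<exists>p\<in>carrier (mult_of K). \<exists>q\<in>carrier (mult_of K).
           group.ord (mult_of K) p = m \<and> group.ord (mult_of K) q = n
           \<and> p \<otimes>\<^bsub>K\<^esub> q \<noteq> \<one>\<^bsub>K\<^esub>"
  shows "(\<forall>p\<in>carrier (mult_of K). \<forall>q\<in>carrier (mult_of K).
            group.ord (mult_of K) p = m \<and> group.ord (mult_of K) q = n
            \<and> p \<otimes>\<^bsub>K\<^esub> q \<noteq> \<one>\<^bsub>K\<^esub>
            \<longrightarrow> group.ord (mult_of K) (p \<otimes>\<^bsub>K\<^esub> q) < lcm m n)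
         \<longleftrightarrow> multiplicity 2 m = multiplicity 2 n \<and> multiplicity 2 n \<ge> 1"
  (is "?lhs \<longleftrightarrow> ?rhs")
proof -
  interpret field K by fact
  interpret M: comm_group "mult_of K"
    using units_comm_group by (simp add: mult_of_is_Units)
  define l where "l = lcm m n"
  have l: "l > 0" "m dvd l" "n dvd l"
    using assms(2,3) by (auto simp: l_def intro: Nat.gr0I)
  show ?thesis
  proof
    assume rhs: ?rhs
    have mult_l: "multiplicity 2 l = multiplicity 2 n"
      using rhs assms(2,3) by (simp add: l_def multiplicity_lcm)
    have even: "2 dvd l"
      using rhs mult_l by (metis not_dvd_imp_multiplicity_0 not_one_le_zero)
    \<comment> \<open>This power squares to 1. It is not 1, since \<open>M.ord z\<close> has the
      full 2-adic valuation of \<open>l\<close> and so cannot divide \<open>l div 2\<close>.\<close>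
    have half: "z [^]\<^bsub>K\<^esub> (l div 2) = \<ominus>\<^bsub>K\<^esub> \<one>\<^bsub>K\<^esub>"
      if z: "z \<in> carrier (mult_of K)" and k: "M.ord z dvd l" "multiplicity 2 (M.ord z) = multiplicity 2 l" for z
    proof -
      have "z [^]\<^bsub>K\<^esub> (l div 2) \<otimes>\<^bsub>K\<^esub> z [^]\<^bsub>K\<^esub> (l div 2) = z [^]\<^bsub>K\<^esub> l"
        using z even by (simp add: nat_pow_mult flip: mult_2)
      also have "\<dots> = \<one>\<^bsub>K\<^esub>"
        using M.pow_eq_id[OF z, of l] k(1) by (simp add: nat_pow_mult_of)
      finally have "z [^]\<^bsub>K\<^esub> (l div 2) \<otimes>\<^bsub>K\<^esub> z [^]\<^bsub>K\<^esub> (l div 2) = \<one>\<^bsub>K\<^esub>" .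
      moreover have "z [^]\<^bsub>K\<^esub> (l div 2) \<noteq> \<one>\<^bsub>K\<^esub>"
        using M.pow_eq_id[OF z, of "l div 2"] k l even dvd_div_prime_iff_multiplicity[of 2 "M.ord z" l]
        by (simp add: nat_pow_mult_of)
      ultimately show ?thesis
        using z square_eq_one[of "z [^]\<^bsub>K\<^esub> (l div 2)"] by auto
    qed
    show ?lhs
    proof (intro ballI impI; elim conjE)
      fix p q assume p: "p \<in> carrier (mult_of K)" and q: "q \<in> carrier (mult_of K)"
        and ord: "M.ord p = m" "M.ord q = n"
      have "(p \<otimes>\<^bsub>K\<^esub> q) [^]\<^bsub>K\<^esub> (l div 2) = \<ominus>\<^bsub>K\<^esub> \<one>\<^bsub>K\<^esub> \<otimes>\<^bsub>K\<^esub> (\<ominus>\<^bsub>K\<^esub> \<one>\<^bsub>K\<^esub>)"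
        using half[OF p] half[OF q] p q ord l rhs mult_l by (simp add: nat_pow_distrib)
      then have "M.ord (p \<otimes>\<^bsub>K\<^esub> q) dvd l div 2"
        using M.pow_eq_id[OF M.m_closed[OF p q], of "l div 2"] by (simp add: nat_pow_mult_of l_minus)
      moreover have "0 < l div 2" "l div 2 < l" using l(1) even by auto
      ultimately show "M.ord (p \<otimes>\<^bsub>K\<^esub> q) < lcm m n"
        unfolding l_def[symmetric] by (meson dvd_imp_le le_less_trans)
    qed
  next
    assume lhs: ?lhs
    show ?rhs
    proof (rule ccontr)
      assume two: "\<not> ?rhs"
      obtain p q where p: "p \<in> carrier (mult_of K)" and q: "q \<in> carrier (mult_of K)"
        and ord: "M.ord p = m" "M.ord q = n" and pq: "p \<otimes>\<^bsub>K\<^esub> q \<noteq> \<one>\<^bsub>K\<^esub>"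
        using assms(4) by blast
      obtain b :: nat where b: "coprime b n" and pqb: "M.ord (p \<otimes>\<^bsub>K\<^esub> q [^]\<^bsub>K\<^esub> b) = l"
        using M.ord_mult_pow_eq_lcm[OF p q] assms(2,3) two
        by (auto simp: ord l_def nat_pow_mult_of)
      let ?q = "q [^]\<^bsub>K\<^esub> b"
      have q': "?q \<in> carrier (mult_of K)" "M.ord ?q = n"
        using M.ord_pow_coprime[OF q ord(2) b assms(3)] M.nat_pow_closed[OF q, of b]
        by (simp_all add: nat_pow_mult_of)
      \<comment> \<open>A trivial product would give \<open>l = 1\<close>, hence \<open>p\<close>
        and \<open>q\<close> would both be 1, contradicting the choice of a pair with nontrivial
        product.\<close>
      have "p \<otimes>\<^bsub>K\<^esub> ?q \<noteq> \<one>\<^bsub>K\<^esub>"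
      proof
        assume "p \<otimes>\<^bsub>K\<^esub> ?q = \<one>\<^bsub>K\<^esub>"
        with pqb have "l = 1" using M.ord_id by simp
        then have "m = 1" "n = 1" by (auto simp: l_def)
        then have "p = \<one>\<^bsub>K\<^esub>" "q = \<one>\<^bsub>K\<^esub>"
          using M.ord_eq_1 p q ord by auto
        with pq show False by simp
      qed
      then have "M.ord (p \<otimes>\<^bsub>K\<^esub> ?q) < lcm m n"
        using lhs p q' ord by blast
      with pqb show False by (simp add: l_def)
    qed
  qed
qed

end
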